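(* If $G$ is the incidence graph of a symmetric $\mathrm{BIBD}(v,b,r,k,1)$ with $k \ge 3$, then $\zeta(G) = k$. In particular, the incidence graph of a projective plane of order $q \ge 2$ has localization number $q+1$.
   Context: A $\mathrm{BIBD}(v,b,r,k,\lambda)$ is a set $X$ of $v$ points together with a collection $\mathcal{B}$ of $b$ blocks (subsets of $X$) such that every block has size $k$, every point lies in exactly $r$ blocks, and every pair of distinct points lies in exactly $\lambda$ blocks; it is symmetric if $v=b$ (then $r=k$). A projective plane of order $q$ is a symmetric $\mathrm{BIBD}(q^2+q+1,q^2+q+1,q+1,q+1,1)$. The incidence graph is the bipartite graph on $X \cup \mathcal{B}$ with $x \sim B$ iff $x \in B$. Localization game on a connected graph $G$ with $k$ cops: the robber chooses a starting vertex, invisible to the cops. Each round the cops choose any $k$ vertices (no adjacency restriction) and each learns its distance to the robber; the cops win if after finitely many rounds they determine the robber's vertex uniquely; otherwise the robber moves to a neighbour or stays. The robber knows the cops' strategy. $\zeta(G)$ is the least $k$ for which $k$ cops can guarantee capture. *)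

theory Defs
  imports "Graph_Theory.Graph_Theory"
begin

text \<open>
  An undirected graph is a symmetric \<^typ>\<open>'v pair_pre_digraph\<close>, as usual in \<open>Graph_Theory\<close>.
\<close>

definition graph_dist :: "'v pair_pre_digraph \<Rightarrow> 'v \<Rightarrow> 'v \<Rightarrow> ereal" where
  "graph_dist G u v = wf_digraph.\<mu> (with_proj G) (\<lambda>_. 1) u v"

definition robber_walk :: "'v pair_pre_digraph \<Rightarrow> (nat \<Rightarrow> 'v) \<Rightarrow> bool" where
  "robber_walk G \<rho> \<longleftrightarrow>
     (\<forall>n. \<rho> n \<in> pverts G \<and> (\<rho> (Suc n) = \<rho> n \<or> (\<rho> n, \<rho> (Suc n)) \<in> parcs G))"

text \<open>
  A cop strategy maps the list of all distance vectors observed in the earlier rounds to the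
  vertices probed in the current round; two cops may probe the same vertex.
\<close>

type_synonym 'v cop_strategy = "ereal list list \<Rightarrow> 'v list"

definition cop_strategy :: "'v pair_pre_digraph \<Rightarrow> nat \<Rightarrow> 'v cop_strategy \<Rightarrow> bool" where
  "cop_strategy G k \<sigma> \<longleftrightarrow> (\<forall>h. length (\<sigma> h) = k \<and> set (\<sigma> h) \<subseteq> pverts G)"

primrec observations ::
  "'v pair_pre_digraph \<Rightarrow> 'v cop_strategy \<Rightarrow> (nat \<Rightarrow> 'v) \<Rightarrow> nat \<Rightarrow> ereal list list"
where
  "observations G \<sigma> \<rho> 0 = []"
| "observations G \<sigma> \<rho> (Suc n) =
     observations G \<sigma> \<rho> n @ [map (\<lambda>c. graph_dist G c (\<rho> n)) (\<sigma> (observations G \<sigma> \<rho> n))]"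

text \<open>
  The robber is located in round \<open>n\<close> if every walk compatible with the observations of the
  rounds \<open>0, \<dots>, n\<close> is at the same vertex in round \<open>n\<close>. Since the walk \<open>\<rho>\<close> is quantified after
  the strategy \<open>\<sigma>\<close>, the robber knows the strategy.
\<close>

definition located ::
  "'v pair_pre_digraph \<Rightarrow> 'v cop_strategy \<Rightarrow> (nat \<Rightarrow> 'v) \<Rightarrow> nat \<Rightarrow> bool"
where
  "located G \<sigma> \<rho> n \<longleftrightarrow>
     (\<forall>\<rho>'. robber_walk G \<rho>' \<and> observations G \<sigma> \<rho>' (Suc n) = observations G \<sigma> \<rho> (Suc n)
        \<longrightarrow> \<rho>' n = \<rho> n)"

definition cops_win :: "'v pair_pre_digraph \<Rightarrow> nat \<Rightarrow> bool" where
  "cops_win G k \<longleftrightarrow>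
     (\<exists>\<sigma>. cop_strategy G k \<sigma> \<and> (\<forall>\<rho>. robber_walk G \<rho> \<longrightarrow> (\<exists>n. located G \<sigma> \<rho> n)))"

definition localization_number :: "'v pair_pre_digraph \<Rightarrow> nat" where
  "localization_number G = (LEAST k. cops_win G k)"

text \<open>
  The condition \<open>X \<noteq> {}\<close> only excludes the empty design, for which \<open>r\<close> and \<open>k\<close> would be arbitrary.
\<close>

definition bibd ::
  "'a set \<Rightarrow> 'a set set \<Rightarrow> nat \<Rightarrow> nat \<Rightarrow> nat \<Rightarrow> nat \<Rightarrow> nat \<Rightarrow> bool"
where
  "bibd X \<B> v b r k l \<longleftrightarrow>
     finite X \<and> X \<noteq> {} \<and> card X = v \<and> \<B> \<subseteq> Pow X \<and> card \<B> = b \<and>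
     (\<forall>B\<in>\<B>. card B = k) \<and>
     (\<forall>x\<in>X. card {B \<in> \<B>. x \<in> B} = r) \<and>
     (\<forall>x\<in>X. \<forall>y\<in>X. x \<noteq> y \<longrightarrow> card {B \<in> \<B>. x \<in> B \<and> y \<in> B} = l)"

definition symmetric_bibd ::
  "'a set \<Rightarrow> 'a set set \<Rightarrow> nat \<Rightarrow> nat \<Rightarrow> nat \<Rightarrow> nat \<Rightarrow> nat \<Rightarrow> bool"
where
  "symmetric_bibd X \<B> v b r k l \<longleftrightarrow> bibd X \<B> v b r k l \<and> v = b"

definition projective_plane :: "'a set \<Rightarrow> 'a set set \<Rightarrow> nat \<Rightarrow> bool" where
  "projective_plane X \<B> q \<longleftrightarrow>
     symmetric_bibd X \<B> (q\<^sup>2 + q + 1) (q\<^sup>2 + q + 1) (q + 1) (q + 1) 1"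

definition incidence_graph :: "'a set \<Rightarrow> 'a set set \<Rightarrow> ('a + 'a set) pair_pre_digraph" where
  "incidence_graph X \<B> =
     \<lparr> pverts = Inl ` X \<union> Inr ` \<B>,
       parcs = {(Inl x, Inr B) | x B. x \<in> X \<and> B \<in> \<B> \<and> x \<in> B} \<union>
               {(Inr B, Inl x) | x B. x \<in> X \<and> B \<in> \<B> \<and> x \<in> B} \<rparr>"

lemma pair_graph_incidence_graph:
  assumes "bibd X \<B> v b r k l"
  shows "pair_graph (incidence_graph X \<B>)"
proof -
  have fin: "finite (Inl ` X \<union> Inr ` \<B> :: ('a + 'a set) set)"
    using assms by (auto simp: bibd_def dest: finite_subset)
  have sub: "parcs (incidence_graph X \<B>)
      \<subseteq> (Inl ` X \<union> Inr ` \<B>) \<times> (Inl ` X \<union> Inr ` \<B>)"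
    by (auto simp: incidence_graph_def)
  have "finite (parcs (incidence_graph X \<B>))"
    using finite_subset[OF sub] fin by blast
  then show ?thesis
    using fin by unfold_locales
      (auto simp: incidence_graph_def symmetric_def intro!: symI)
qed

end

theory Submission
  imports Defs
begin

text \<open>
  A symmetric design with \<open>\<lambda> = 1\<close> is self-dual as an axiom system: any two points lie on one block
  and any two blocks meet in one point. With at most \<open>k - 1\<close> probes, the neighbours of two
  possible robber positions on the same side are never all distinguished: each probe singles out
  at most one of the \<open>k\<close> neighbours of \<open>u\<close> and at most one of those of \<open>w\<close>, so separating both
  pencils would force some probe to lie on a block through \<open>u\<close> and another through \<open>w\<close>, and
  these two blocks get the same distances. Conversely, \<open>k\<close> cops first confine the robber to the
  neighbours of a single vertex; from \<open>t\<close> such candidates they probe these candidates together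
  with \<open>k - t\<close> transversals, leaving at most \<open>t - 1\<close> candidates, again with a common neighbour.
\<close>

section \<open>Localization games\<close>

lemma observations_cong:
  "(\<And>i. i < n \<Longrightarrow> \<rho> i = \<rho>' i) \<Longrightarrow> observations G \<sigma> \<rho> n = observations G \<sigma> \<rho>' n"
  by (induction n) auto

text \<open>Splits off the first round instead of the last: the rest is a game played by the
  strategy that already holds the first answer in its history. Strategies can thus be composed round
  by round.\<close>

lemma observations_Suc_Cons:
  "observations G \<sigma> \<rho> (Suc n) =
     map (\<lambda>c. graph_dist G c (\<rho> 0)) (\<sigma> []) #
     observations G (\<lambda>h. \<sigma> (map (\<lambda>c. graph_dist G c (\<rho> 0)) (\<sigma> []) # h)) (\<lambda>n. \<rho> (Suc n)) n"
  by (induction n) auto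

lemma robber_walk_Suc: "robber_walk G \<rho> \<Longrightarrow> robber_walk G (\<lambda>n. \<rho> (Suc n))"
  by (auto simp: robber_walk_def)

text \<open>The game in which the cops know beforehand that the robber starts in \<open>C\<close>;
  only walks from \<open>C\<close> compete in the location condition.\<close>

definition cops_win_from :: "'v pair_pre_digraph \<Rightarrow> nat \<Rightarrow> 'v set \<Rightarrow> bool" where
  "cops_win_from G k C \<longleftrightarrow>
     (\<exists>\<sigma>. cop_strategy G k \<sigma> \<and>
       (\<forall>\<rho>. robber_walk G \<rho> \<and> \<rho> 0 \<in> C \<longrightarrow>
         (\<exists>n. \<forall>\<rho>'. robber_walk G \<rho>' \<and> \<rho>' 0 \<in> C \<and>
            observations G \<sigma> \<rho>' (Suc n) = observations G \<sigma> \<rho> (Suc n) \<longrightarrow> \<rho>' n = \<rho> n)))"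

lemma cops_win_if_cops_win_from:
  assumes "cops_win_from G k (pverts G)"
  shows "cops_win G k"
proof -
  have "robber_walk G \<rho> \<and> \<rho> 0 \<in> pverts G \<longleftrightarrow> robber_walk G \<rho>" for \<rho>
    by (auto simp: robber_walk_def)
  then show ?thesis
    using assms unfolding cops_win_from_def cops_win_def located_def conj_assoc[symmetric] by simp
qed

text \<open>The same strategy works: there are fewer walks to beat and fewer competitors to
  exclude.\<close>

lemma cops_win_from_mono:
  assumes "cops_win_from G k C" "C' \<subseteq> C"
  shows "cops_win_from G k C'"
proof -
  obtain \<sigma> where \<sigma>: "cop_strategy G k \<sigma>"
    and win: "\<And>\<rho>. robber_walk G \<rho> \<Longrightarrow> \<rho> 0 \<in> C \<Longrightarrow> \<exists>n. \<forall>\<rho>'. robber_walk G \<rho>' \<and> \<rho>' 0 \<in> C \<and>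
            observations G \<sigma> \<rho>' (Suc n) = observations G \<sigma> \<rho> (Suc n) \<longrightarrow> \<rho>' n = \<rho> n"
    using assms(1) unfolding cops_win_from_def by auto
  have "\<exists>n. \<forall>\<rho>'. robber_walk G \<rho>' \<and> \<rho>' 0 \<in> C' \<and>
      observations G \<sigma> \<rho>' (Suc n) = observations G \<sigma> \<rho> (Suc n) \<longrightarrow> \<rho>' n = \<rho> n"
    if "robber_walk G \<rho>" "\<rho> 0 \<in> C'" for \<rho>
    using win[OF that(1) subsetD[OF assms(2) that(2)]] assms(2) by (elim exE, intro exI) auto
  with \<sigma> show ?thesis unfolding cops_win_from_def by (intro exI[of _ \<sigma>]) simp
qed

text \<open>The vertices where the robber can be after one move from \<open>S\<close>, staying
  included.\<close>

definition closed_nbhd :: "'v pair_pre_digraph \<Rightarrow> 'v set \<Rightarrow> 'v set" where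
  "closed_nbhd G S = S \<union> {w. \<exists>v\<in>S. (v, w) \<in> parcs G}"

text \<open>Analysis of one round. The answer cuts \<open>C\<close> into classes; a singleton class
  means capture, and a class inside \<open>S\<close> lets the cops go on with a strategy for the
  closed neighbourhood of \<open>S\<close>.\<close>

lemma cops_win_from_probe:
  assumes len: "length ps = k" and ps: "set ps \<subseteq> pverts G"
    and step: "\<And>y. y \<in> C \<Longrightarrow>
      (\<forall>y'\<in>C. (\<forall>p\<in>set ps. graph_dist G p y' = graph_dist G p y) \<longrightarrow> y' = y) \<or>
      (\<exists>S. cops_win_from G k (closed_nbhd G S) \<and>
        (\<forall>y'\<in>C. (\<forall>p\<in>set ps. graph_dist G p y' = graph_dist G p y) \<longrightarrow> y' \<in> S))"
  shows "cops_win_from G k C"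
proof -
  define vec where "vec y = map (\<lambda>c. graph_dist G c y) ps" for y
  have vec_eq: "vec y = vec y' \<longleftrightarrow> (\<forall>p\<in>set ps. graph_dist G p y = graph_dist G p y')" for y y'
    by (auto simp: vec_def)
  define wins where "wins \<tau> C' \<longleftrightarrow> (\<forall>\<rho>. robber_walk G \<rho> \<and> \<rho> 0 \<in> C' \<longrightarrow>
         (\<exists>n. \<forall>\<rho>'. robber_walk G \<rho>' \<and> \<rho>' 0 \<in> C' \<and>
            observations G \<tau> \<rho>' (Suc n) = observations G \<tau> \<rho> (Suc n) \<longrightarrow> \<rho>' n = \<rho> n))" for \<tau> C'
  \<comment> \<open>The continuation may depend only on the answer \<open>d\<close>, so one strategy
    has to serve every position that yields \<open>d\<close>.\<close>
  have "\<exists>\<tau>. cop_strategy G k \<tau> \<and>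
      (\<forall>y\<in>C. vec y = d \<longrightarrow> (\<forall>y'\<in>C. vec y' = d \<longrightarrow> y' = y) \<or>
        (\<exists>S. wins \<tau> (closed_nbhd G S) \<and> (\<forall>y'\<in>C. vec y' = d \<longrightarrow> y' \<in> S)))" for d
  proof (cases "\<exists>S. cops_win_from G k (closed_nbhd G S) \<and> (\<forall>y'\<in>C. vec y' = d \<longrightarrow> y' \<in> S)")
    case True
    then obtain S \<tau> where "cop_strategy G k \<tau>" "wins \<tau> (closed_nbhd G S)"
      "\<forall>y'\<in>C. vec y' = d \<longrightarrow> y' \<in> S"
      unfolding cops_win_from_def wins_def by blast
    then show ?thesis by blast
  next
    case False
    \<comment> \<open>Here the class of \<open>d\<close> has at most one element, so the robber is
      already located and the constant strategy is a mere default.\<close>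
    have "cop_strategy G k (\<lambda>_. ps)"
      using len ps by (auto simp: cop_strategy_def)
    moreover have "\<forall>y'\<in>C. vec y' = d \<longrightarrow> y' = y" if "y \<in> C" "vec y = d" for y
      using step[OF that(1)] False unfolding vec_eq[symmetric] that(2) by blast
    ultimately show ?thesis by blast
  qed
  then obtain \<tau> where \<tau>: "\<And>d. cop_strategy G k (\<tau> d)"
    "\<And>d y. y \<in> C \<Longrightarrow> vec y = d \<Longrightarrow> (\<forall>y'\<in>C. vec y' = d \<longrightarrow> y' = y) \<or>
        (\<exists>S. wins (\<tau> d) (closed_nbhd G S) \<and> (\<forall>y'\<in>C. vec y' = d \<longrightarrow> y' \<in> S))"
    by metis
  define \<sigma> where "\<sigma> h = (case h of [] \<Rightarrow> ps | d # h' \<Rightarrow> \<tau> d h')" for h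
  have \<sigma>: "cop_strategy G k \<sigma>"
    using \<tau>(1) len ps by (auto simp: cop_strategy_def \<sigma>_def split: list.splits)
  have obs: "observations G \<sigma> \<rho> (Suc n) =
      vec (\<rho> 0) # observations G (\<tau> (vec (\<rho> 0))) (\<lambda>n. \<rho> (Suc n)) n" for \<rho> n
    unfolding observations_Suc_Cons by (simp add: \<sigma>_def vec_def)
  have "\<exists>n. \<forall>\<rho>'. robber_walk G \<rho>' \<and> \<rho>' 0 \<in> C \<and>
      observations G \<sigma> \<rho>' (Suc n) = observations G \<sigma> \<rho> (Suc n) \<longrightarrow> \<rho>' n = \<rho> n"
    if \<rho>: "robber_walk G \<rho>" "\<rho> 0 \<in> C" for \<rho>
    using \<tau>(2)[OF \<rho>(2) refl]
  proof (elim disjE exE conjE)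
    assume "\<forall>y'\<in>C. vec y' = vec (\<rho> 0) \<longrightarrow> y' = \<rho> 0"
    then show ?thesis
      by (intro exI[of _ 0]) (auto simp: obs simp del: observations.simps)
  next
    fix S assume S: "wins (\<tau> (vec (\<rho> 0))) (closed_nbhd G S)"
      "\<forall>y'\<in>C. vec y' = vec (\<rho> 0) \<longrightarrow> y' \<in> S"
    have nb: "\<rho>' (Suc 0) \<in> closed_nbhd G S"
      if "robber_walk G \<rho>'" "\<rho>' 0 \<in> C" "vec (\<rho>' 0) = vec (\<rho> 0)" for \<rho>'
    proof -
      have "\<rho>' 0 \<in> S" using S(2) that by blast
      moreover have "\<rho>' (Suc 0) = \<rho>' 0 \<or> (\<rho>' 0, \<rho>' (Suc 0)) \<in> parcs G"
        using that(1) by (simp add: robber_walk_def)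
      ultimately show ?thesis by (auto simp: closed_nbhd_def)
    qed
    obtain n where n: "\<And>\<rho>'. robber_walk G \<rho>' \<Longrightarrow> \<rho>' 0 \<in> closed_nbhd G S \<Longrightarrow>
        observations G (\<tau> (vec (\<rho> 0))) \<rho>' (Suc n) =
        observations G (\<tau> (vec (\<rho> 0))) (\<lambda>n. \<rho> (Suc n)) (Suc n) \<Longrightarrow> \<rho>' n = \<rho> (Suc n)"
      using S(1) robber_walk_Suc[OF \<rho>(1)] nb[OF \<rho> refl] unfolding wins_def by blast
    have "\<rho>' (Suc n) = \<rho> (Suc n)"
      if \<rho>': "robber_walk G \<rho>'" "\<rho>' 0 \<in> C"
        "observations G \<sigma> \<rho>' (Suc (Suc n)) = observations G \<sigma> \<rho> (Suc (Suc n))" for \<rho>'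
    proof -
      have eq: "vec (\<rho>' 0) = vec (\<rho> 0)"
        "observations G (\<tau> (vec (\<rho> 0))) (\<lambda>n. \<rho>' (Suc n)) (Suc n) =
         observations G (\<tau> (vec (\<rho> 0))) (\<lambda>n. \<rho> (Suc n)) (Suc n)"
        using \<rho>'(3) unfolding obs by auto
      show ?thesis
        using n[OF robber_walk_Suc[OF \<rho>'(1)] nb[OF \<rho>'(1,2) eq(1)] eq(2)] .
    qed
    then show ?thesis by blast
  qed
  with \<sigma> show ?thesis unfolding cops_win_from_def by blast
qed

text \<open>Compactness in the form of Koenig's lemma: the limit is a branch through the finitely
  branching tree of prefixes shared by infinitely many of the sequences.\<close>

lemma konig_prefixes:
  fixes w :: "nat \<Rightarrow> nat \<Rightarrow> 'v"
  assumes fin: "finite V" and V: "\<And>m i. w m i \<in> V"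
  obtains \<rho> where "\<And>n. \<exists>m\<ge>n. \<forall>i\<le>n. w m i = \<rho> i"
proof -
  define inf where "inf n f \<longleftrightarrow> infinite {m. \<forall>i<n. w m i = f i}" for n and f :: "nat \<Rightarrow> 'v"
  have "\<exists>f. \<forall>n. inf n (f n) \<and> (\<forall>i<n. f (Suc n) i = f n i)"
  proof (rule dependent_nat_choice)
    show "\<exists>f. inf 0 f" by (simp add: inf_def)
  next
    fix f n assume "inf n f"
    then have "infinite {m. \<forall>i<n. w m i = f i}" by (simp add: inf_def)
    \<comment> \<open>Pigeonhole: an infinite index set is split by the value at \<open>n\<close>
      into finitely many parts, so one part is infinite.\<close>
    moreover have "{m. \<forall>i<n. w m i = f i} =
        (\<Union>v\<in>V. {m. (\<forall>i<n. w m i = f i) \<and> w m n = v})"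
      using V by auto
    ultimately obtain v where "infinite {m. (\<forall>i<n. w m i = f i) \<and> w m n = v}"
      using fin by auto
    moreover have "{m. (\<forall>i<n. w m i = f i) \<and> w m n = v} = {m. \<forall>i<Suc n. w m i = (f(n := v)) i}"
      by (auto simp: less_Suc_eq)
    ultimately have "inf (Suc n) (f(n := v))" unfolding inf_def by simp
    then show "\<exists>g. inf (Suc n) g \<and> (\<forall>i<n. g i = f i)"
      by (intro exI[of _ "f(n := v)"]) auto
  qed
  then obtain f where f: "\<And>n. inf n (f n)" "\<And>n i. i < n \<Longrightarrow> f (Suc n) i = f n i" by blast
  have ext: "i < n \<Longrightarrow> n \<le> m \<Longrightarrow> f m i = f n i" for i n m
    by (induction m rule: nat_induct) (auto simp: le_Suc_eq f(2))
  \<comment> \<open>The limit takes its value at \<open>i\<close> from the prefix of length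
    \<open>Suc i\<close>, the first one that fixes it.\<close>
  have "\<exists>m\<ge>n. \<forall>i\<le>n. w m i = f (Suc i) i" for n
  proof -
    obtain m where "m \<ge> n" "\<forall>i<Suc n. w m i = f (Suc n) i"
      using f(1)[of "Suc n"] unfolding inf_def infinite_nat_iff_unbounded_le by blast
    moreover have "f (Suc n) i = f (Suc i) i" if "i \<le> n" for i
      using ext[of i "Suc i" "Suc n"] that by simp
    ultimately show ?thesis by (intro exI[of _ m]) auto
  qed
  then show ?thesis by (rule that)
qed

text \<open>
  Which of two indistinguishable vertices can be continued depends on the later probes, so the
  evading walk only arises as a limit of finite walks.
\<close>

lemma not_cops_win_if_indistinguishable:
  assumes fin: "finite (pverts G)" and wf: "\<And>u v. (u, v) \<in> parcs G \<Longrightarrow> v \<in> pverts G"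
    and R: "R u0 w0" "u0 \<in> pverts G" "w0 \<in> pverts G"
    and neq: "\<And>u w. R u w \<Longrightarrow> u \<noteq> w"
    and step: "\<And>u w ps. R u w \<Longrightarrow> u \<in> pverts G \<Longrightarrow> w \<in> pverts G \<Longrightarrow> length ps = j \<Longrightarrow>
      set ps \<subseteq> pverts G \<Longrightarrow>
      \<exists>a b. R a b \<and> a \<in> closed_nbhd G {u, w} \<and> b \<in> closed_nbhd G {u, w} \<and>
        (\<forall>p\<in>set ps. graph_dist G p a = graph_dist G p b)"
  shows "\<not> cops_win G j"
proof
  assume "cops_win G j"
  then obtain \<sigma> where \<sigma>: "cop_strategy G j \<sigma>"
    and win: "\<And>\<rho>. robber_walk G \<rho> \<Longrightarrow> \<exists>n. located G \<sigma> \<rho> n"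
    unfolding cops_win_def by blast
  let ?obs = "observations G \<sigma>"
  have probe: "length (\<sigma> h) = j" "set (\<sigma> h) \<subseteq> pverts G" for h
    using \<sigma> by (auto simp: cop_strategy_def)
  \<comment> \<open>Invariant: two walks with equal answers through round \<open>n\<close> that are
    at \<open>R\<close>-related vertices in that round.\<close>
  define J where "J n = (\<lambda>(\<alpha>, \<beta>). robber_walk G \<alpha> \<and> robber_walk G \<beta> \<and>
      ?obs \<alpha> (Suc n) = ?obs \<beta> (Suc n) \<and> R (\<alpha> n) (\<beta> n))" for n
  define extend where "extend \<alpha> n a = (\<lambda>i. if i \<le> n then \<alpha> i else a)"
    for \<alpha> :: "nat \<Rightarrow> 'a" and n a
  have walk_extend: "robber_walk G (extend \<alpha> n a)"
    if "robber_walk G \<alpha>" "a \<in> closed_nbhd G {\<alpha> n}" for \<alpha> n a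
    unfolding robber_walk_def
  proof (intro allI conjI)
    fix i
    have a: "a = \<alpha> n \<or> (\<alpha> n, a) \<in> parcs G"
      using that(2) by (auto simp: closed_nbhd_def)
    have \<alpha>: "\<alpha> i \<in> pverts G" "\<alpha> (Suc i) = \<alpha> i \<or> (\<alpha> i, \<alpha> (Suc i)) \<in> parcs G" for i
      using that(1) by (auto simp: robber_walk_def)
    show "extend \<alpha> n a i \<in> pverts G"
      using a \<alpha>(1) wf by (auto simp: extend_def)
    consider "i < n" | "i = n" | "i > n" by linarith
    then show "extend \<alpha> n a (Suc i) = extend \<alpha> n a i \<or>
        (extend \<alpha> n a i, extend \<alpha> n a (Suc i)) \<in> parcs G"
      using a \<alpha>(2) by cases (auto simp: extend_def)
  qed
  have obs_extend: "?obs (extend \<alpha> n a) (Suc n) = ?obs \<alpha> (Suc n)" for \<alpha> n a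
    by (rule observations_cong) (simp add: extend_def)
  \<comment> \<open>Successive pairs agree in their earlier answers, though not necessarily in their
    earlier positions.\<close>
  have "\<exists>p. \<forall>n. J n (p n) \<and> ?obs (fst (p (Suc n))) (Suc n) = ?obs (fst (p n)) (Suc n)"
  proof (rule dependent_nat_choice)
    obtain a b where ab: "R a b" "a \<in> closed_nbhd G {u0, w0}" "b \<in> closed_nbhd G {u0, w0}"
      "\<forall>p\<in>set (\<sigma> []). graph_dist G p a = graph_dist G p b"
      using step[OF R probe] by blast
    have "a \<in> pverts G" "b \<in> pverts G"
      using ab(2,3) R wf by (auto simp: closed_nbhd_def)
    then have "J 0 (\<lambda>_. a, \<lambda>_. b)"
      using ab by (auto simp: J_def robber_walk_def)
    then show "\<exists>p. J 0 p" by blast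
  next
    fix p n assume "J n p"
    then obtain \<alpha> \<beta> where p: "p = (\<alpha>, \<beta>)" and \<alpha>\<beta>: "robber_walk G \<alpha>" "robber_walk G \<beta>"
      "?obs \<alpha> (Suc n) = ?obs \<beta> (Suc n)" "R (\<alpha> n) (\<beta> n)"
      by (cases p) (auto simp: J_def)
    define h where "h = ?obs \<alpha> (Suc n)"
    have "\<alpha> n \<in> pverts G" "\<beta> n \<in> pverts G"
      using \<alpha>\<beta>(1,2) by (auto simp: robber_walk_def)
    then obtain a b where ab: "R a b" "a \<in> closed_nbhd G {\<alpha> n, \<beta> n}" "b \<in> closed_nbhd G {\<alpha> n, \<beta> n}"
      "\<forall>p\<in>set (\<sigma> h). graph_dist G p a = graph_dist G p b"
      using step[OF \<alpha>\<beta>(4) _ _ probe] by blast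
    \<comment> \<open>The new vertex may be reached from either old walk; as both have produced the
      answers \<open>h\<close>, this choice leaves the history unchanged.\<close>
    have "\<exists>\<gamma>. robber_walk G \<gamma> \<and> ?obs \<gamma> (Suc n) = h \<and> \<gamma> (Suc n) = c"
      if "c \<in> closed_nbhd G {\<alpha> n, \<beta> n}" for c
    proof -
      have "c \<in> closed_nbhd G {\<alpha> n} \<or> c \<in> closed_nbhd G {\<beta> n}"
        using that by (auto simp: closed_nbhd_def)
      moreover have "extend \<gamma> n c (Suc n) = c" for \<gamma> by (simp add: extend_def)
      ultimately show ?thesis
        using walk_extend[OF \<alpha>\<beta>(1)] walk_extend[OF \<alpha>\<beta>(2)] obs_extend \<alpha>\<beta>(3) h_def by metis
    qed
    then obtain \<gamma> \<delta> where \<gamma>: "robber_walk G \<gamma>" "?obs \<gamma> (Suc n) = h" "\<gamma> (Suc n) = a"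
      and \<delta>: "robber_walk G \<delta>" "?obs \<delta> (Suc n) = h" "\<delta> (Suc n) = b"
      using ab(2,3) by meson
    have "?obs \<gamma> (Suc (Suc n)) = ?obs \<delta> (Suc (Suc n))"
      using ab(4) unfolding observations.simps(2)[of G \<sigma> _ "Suc n"] \<gamma>(2,3) \<delta>(2,3) by simp
    then have "J (Suc n) (\<gamma>, \<delta>)"
      using \<gamma>(1,3) \<delta>(1,3) ab(1) unfolding J_def by (simp del: observations.simps)
    then show "\<exists>p'. J (Suc n) p' \<and> ?obs (fst p') (Suc n) = ?obs (fst p) (Suc n)"
      using \<gamma>(2) unfolding p h_def fst_conv by (intro exI[of _ "(\<gamma>, \<delta>)"]) (simp del: observations.simps)
  qed
  then obtain P where P: "\<And>n. J n (P n)"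
    "\<And>n. ?obs (fst (P (Suc n))) (Suc n) = ?obs (fst (P n)) (Suc n)"
    by blast
  define \<alpha> \<beta> where "\<alpha> n = fst (P n)" and "\<beta> n = snd (P n)" for n
  have \<alpha>\<beta>: "robber_walk G (\<alpha> n)" "robber_walk G (\<beta> n)"
    "?obs (\<alpha> n) (Suc n) = ?obs (\<beta> n) (Suc n)" "R (\<alpha> n n) (\<beta> n n)" for n
    using P(1)[of n] by (simp_all add: J_def \<alpha>_def \<beta>_def case_prod_unfold del: observations.simps)
  have prefix: "?obs \<gamma> n = ?obs \<gamma>' n" if "?obs \<gamma> m = ?obs \<gamma>' m" "n \<le> m" for \<gamma> \<gamma>' n m
    using that(2,1) by (induction rule: inc_induct) auto
  have \<alpha>_obs: "?obs (\<alpha> m) (Suc n) = ?obs (\<alpha> n) (Suc n)" if "n \<le> m" for n m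
    using that
  proof (induction rule: dec_induct)
    case (step m)
    have "?obs (\<alpha> (Suc m)) (Suc n) = ?obs (\<alpha> m) (Suc n)"
      by (rule prefix[OF P(2)[of m, folded \<alpha>_def]]) (use step in simp)
    with step.IH show ?case by (rule trans[rotated])
  qed simp
  obtain \<rho> where \<rho>: "\<And>n. \<exists>m\<ge>n. \<forall>i\<le>n. \<alpha> m i = \<rho> i"
    by (rule konig_prefixes[OF fin, of \<alpha>]) (use \<alpha>\<beta>(1) in \<open>auto simp: robber_walk_def\<close>)
  have "robber_walk G \<rho>"
    unfolding robber_walk_def
  proof
    fix n
    obtain m where "\<forall>i\<le>Suc n. \<alpha> m i = \<rho> i" using \<rho>[of "Suc n"] by blast
    then have "\<alpha> m n = \<rho> n" "\<alpha> m (Suc n) = \<rho> (Suc n)" by auto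
    then show "\<rho> n \<in> pverts G \<and> (\<rho> (Suc n) = \<rho> n \<or> (\<rho> n, \<rho> (Suc n)) \<in> parcs G)"
      using \<alpha>\<beta>(1)[of m] by (metis robber_walk_def)
  qed
  then obtain n where n: "located G \<sigma> \<rho> n" using win by blast
  obtain m where m: "m \<ge> n" "\<forall>i\<le>n. \<alpha> m i = \<rho> i" using \<rho> by blast
  \<comment> \<open>The limit walk has the same answers through round \<open>n\<close> as
    \<open>\<alpha> n\<close> and \<open>\<beta> n\<close>, which are then at different vertices;
    hence it is not located in round \<open>n\<close>.\<close>
  have "?obs \<rho> (Suc n) = ?obs (\<alpha> m) (Suc n)"
    by (rule observations_cong) (use m in simp)
  then have "?obs (\<alpha> n) (Suc n) = ?obs \<rho> (Suc n)" "?obs (\<beta> n) (Suc n) = ?obs \<rho> (Suc n)"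
    using \<alpha>_obs[OF m(1)] \<alpha>\<beta>(3)[of n] by (simp_all del: observations.simps)
  then have "\<alpha> n n = \<beta> n n"
    using n \<alpha>\<beta>(1,2)[of n] unfolding located_def by metis
  then show False using neq[OF \<alpha>\<beta>(4)] by blast
qed


section \<open>Incidence graphs of projective planes\<close>

text \<open>
  Points and blocks enter symmetrically: \<open>side\<close> is the bipartition, and every statement below
  also covers its dual.
\<close>

locale plane_graph = pair_graph G for G :: "'v pair_pre_digraph" +
  fixes side :: "'v \<Rightarrow> bool" and k :: nat
  assumes side_neq: "(u, v) \<in> parcs G \<Longrightarrow> side u \<noteq> side v"
    and common_nbr_ex1: "u \<in> pverts G \<Longrightarrow> v \<in> pverts G \<Longrightarrow> u \<noteq> v \<Longrightarrow> side u = side v \<Longrightarrow>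
      \<exists>!w. (u, w) \<in> parcs G \<and> (v, w) \<in> parcs G"
    and card_nbrs: "u \<in> pverts G \<Longrightarrow> card {w. (u, w) \<in> parcs G} = k"
    and k_ge_3: "3 \<le> k"
    and verts_nonempty: "pverts G \<noteq> {}"
begin

section \<open>Neighbours and distances\<close>

abbreviation adj :: "'v \<Rightarrow> 'v \<Rightarrow> bool" where
  "adj u v \<equiv> (u, v) \<in> parcs G"

definition nbrs :: "'v \<Rightarrow> 'v set" where
  "nbrs u = {w. adj u w}"

lemma adj_sym: "adj u v \<longleftrightarrow> adj v u"
  using arcs_symmetric by blast

lemma adj_verts: "adj u v \<Longrightarrow> u \<in> pverts G" "adj u v \<Longrightarrow> v \<in> pverts G"
  using wellformed' by blast+

lemma not_adj_same_side: "side u = side v \<Longrightarrow> \<not> adj u v"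
  using side_neq by blast

lemma side_nbrs: "adj u a \<Longrightarrow> adj u b \<Longrightarrow> side a = side b"
  using side_neq by blast

lemma side_two_steps: "adj u a \<Longrightarrow> adj a b \<Longrightarrow> side u = side b"
  using side_neq by blast

lemma finite_nbrs [simp]: "finite (nbrs u)"
  by (rule finite_subset[OF _ pair_finite_verts]) (auto simp: nbrs_def adj_verts)

lemma card_nbrs_eq: "u \<in> pverts G \<Longrightarrow> card (nbrs u) = k"
  using card_nbrs by (simp add: nbrs_def)

lemma common_nbr_unique:
  assumes "adj u x" "adj v x" "adj u y" "adj v y" "u \<noteq> v"
  shows "x = y"
proof -
  have "side u = side v" using assms(1,2) side_neq by blast
  with common_nbr_ex1[of u v] assms adj_verts show ?thesis by blast
qed

lemma common_nbr_obtain: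
  assumes "u \<in> pverts G" "v \<in> pverts G" "u \<noteq> v" "side u = side v"
  obtains w where "adj u w" "adj v w"
  using common_nbr_ex1[OF assms] by blast

lemma nbr_obtain:
  assumes "u \<in> pverts G"
  obtains w where "adj u w" "w \<noteq> x"
proof -
  have "\<not> nbrs u \<subseteq> {x}"
    using card_nbrs_eq[OF assms] k_ge_3 card_mono[of "{x}" "nbrs u"] by auto
  then show ?thesis using that by (auto simp: nbrs_def)
qed

text \<open>With unit weights the cost of a walk is its length, so the infimum defining the distance
  is attained by a shortest walk.\<close>

lemma graph_dist_eqI:
  assumes "awalk u p v" "length p = n" "\<And>q. awalk u q v \<Longrightarrow> n \<le> length q"
  shows "graph_dist G u v = ereal (real n)"
proof -
  have cost: "awalk_cost (\<lambda>_. 1) q = real (length q)" for q :: "('v \<times> 'v) list"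
    by (induction q) auto
  have "\<mu> (\<lambda>_. 1) u v = ereal (real n)"
    unfolding \<mu>_def cost
    by (rule INF_eqI) (use assms in auto)
  then show ?thesis by (simp add: graph_dist_def)
qed

text \<open>Parity: two steps return to the same side, so non-adjacent vertices on opposite sides
  are at least three steps apart.\<close>

lemma length_awalk_ge:
  assumes "awalk u q v"
  shows "length q \<ge> (if u = v then 0 else if adj u v then 1 else if side u = side v then 2 else 3)"
proof -
  consider "q = []" | a where "q = [a]" | a b where "q = [a, b]" | "length q \<ge> 3"
    by (cases q; cases "tl q"; cases "tl (tl q)") auto
  then show ?thesis
    using assms
    by cases (auto simp: awalk_simps dest: side_two_steps)
qed

lemma graph_dist_eq:
  assumes "u \<in> pverts G" "v \<in> pverts G"
  shows "graph_dist G u v =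
    (if u = v then 0 else if adj u v then 1 else if side u = side v then 2 else 3)"
proof -
  note ge = length_awalk_ge[of u _ v]
  consider "u = v" | "u \<noteq> v" "adj u v" | "u \<noteq> v" "\<not> adj u v" "side u = side v"
    | "u \<noteq> v" "\<not> adj u v" "side u \<noteq> side v" by blast
  then show ?thesis
  proof cases
    case 1
    then show ?thesis
      using graph_dist_eqI[of u "[]" v 0] assms by (simp add: awalk_simps)
  next
    case 2
    then show ?thesis
      using graph_dist_eqI[of u "[(u, v)]" v 1] ge assms by (simp add: awalk_simps)
  next
    case 3
    then obtain w where "adj u w" "adj w v"
      using common_nbr_obtain[OF assms] adj_sym by metis
    then show ?thesis
      using graph_dist_eqI[of u "[(u, w), (w, v)]" v 2] ge assms 3 by (simp add: awalk_simps)
  next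
    case 4
    \<comment> \<open>A neighbour \<open>x\<close> of \<open>v\<close> lies on the side of
      \<open>u\<close>, so \<open>u\<close> and \<open>x\<close> have a common neighbour; this
      yields a walk of length three.\<close>
    obtain x where x: "adj v x" "x \<noteq> u" using nbr_obtain[OF assms(2)] by blast
    then have "side u = side x" using 4 side_neq by blast
    then obtain w where "adj u w" "adj x w"
      using common_nbr_obtain[of u x] x adj_verts assms by metis
    then have "awalk u [(u, w), (w, x), (x, v)] v"
      using x assms by (simp add: awalk_simps adj_sym)
    then show ?thesis
      using graph_dist_eqI[of u _ v 3] ge 4 by simp
  qed
qed

definition same_dist :: "'v \<Rightarrow> 'v \<Rightarrow> 'v \<Rightarrow> bool" where
  "same_dist p y y' \<longleftrightarrow> graph_dist G p y' = graph_dist G p y"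

text \<open>Distances 0 and 2 indicate the side of \<open>p\<close>, 1 and 3 the other side. Every
  probe thus reveals the side, and beyond that only whether the robber is at \<open>p\<close> or
  next to it.\<close>

lemma same_dist_iff:
  assumes "p \<in> pverts G" "y \<in> pverts G" "y' \<in> pverts G"
  shows "same_dist p y y' \<longleftrightarrow>
    side y = side y' \<and> (p = y \<longleftrightarrow> p = y') \<and> (adj p y \<longleftrightarrow> adj p y')"
  using side_neq[of p y] side_neq[of p y'] assms by (auto simp: same_dist_def graph_dist_eq)

subsection \<open>The robber evades fewer than \<open>k\<close> cops\<close>

text \<open>
  A probe tells at most one neighbour of \<open>u\<close> apart from the others, namely the one it hits.
\<close>

definition hits :: "'v \<Rightarrow> 'v \<Rightarrow> 'v \<Rightarrow> bool" where
  "hits u p a \<longleftrightarrow> p = a \<or> adj p a \<and> p \<noteq> u"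

text \<open>A probe on the side of the neighbours of \<open>u\<close> can hit only itself; one on
  the side of \<open>u\<close>, different from \<open>u\<close>, has a unique common neighbour with
  \<open>u\<close>.\<close>

lemma hits_unique:
  assumes "adj u a" "adj u b" "hits u p a" "hits u p b"
  shows "a = b"
proof -
  have "side a = side b" using assms(1,2) side_nbrs by blast
  then show ?thesis
    using assms common_nbr_unique[of u a p b] not_adj_same_side unfolding hits_def by metis
qed

text \<open>The unhit neighbours of \<open>u\<close> look alike to all probes, so at most one of the
  \<open>k\<close> neighbours is unhit. Fewer than \<open>k\<close> probes must then hit the
  remaining ones with none to spare: each probe hits, and no two hit the same neighbour.\<close>

lemma separating_probes_hit:
  assumes u: "u \<in> pverts G" and P: "P \<subseteq> pverts G" "card P < k" "finite P"
    and sep: "\<forall>a b. adj u a \<longrightarrow> adj u b \<longrightarrow> (\<forall>p\<in>P. same_dist p a b) \<longrightarrow> a = b"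
  shows "card P = k - 1" "\<And>p. p \<in> P \<Longrightarrow> \<exists>a. adj u a \<and> hits u p a"
    "\<And>p p' a. p \<in> P \<Longrightarrow> p' \<in> P \<Longrightarrow> adj u a \<Longrightarrow> hits u p a \<Longrightarrow> hits u p' a \<Longrightarrow> p = p'"
proof -
  define H where "H = {p \<in> P. \<exists>a. adj u a \<and> hits u p a}"
  define h where "h p = (THE a. adj u a \<and> hits u p a)" for p
  have h: "h p = a" if "adj u a" "hits u p a" for p a
    unfolding h_def using that hits_unique by blast
  define U where "U = {a. adj u a \<and> (\<forall>p\<in>P. \<not> hits u p a)}"
  have "a = b" if "a \<in> U" "b \<in> U" for a b
  proof (rule sep[THEN spec, THEN spec, THEN mp, THEN mp, THEN mp])
    show "\<forall>p\<in>P. same_dist p a b"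
    proof
      fix p assume p: "p \<in> P"
      with that have "p \<noteq> a" "p \<noteq> b" "adj p a \<longleftrightarrow> p = u" "adj p b \<longleftrightarrow> p = u"
        by (auto simp: U_def hits_def)
      moreover have "side a = side b" using that side_nbrs unfolding U_def by blast
      ultimately show "same_dist p a b"
        using that P(1) p adj_verts by (subst same_dist_iff) (auto simp: U_def)
    qed
  qed (use that in \<open>auto simp: U_def\<close>)
  then have "is_singleton U \<or> U = {}" by (metis all_not_in_conv is_singletonI')
  then have U: "card U \<le> 1" by (auto simp: is_singleton_def)
  have fin: "finite H" using P(3) by (simp add: H_def)
  have "finite U" by (rule finite_subset[OF _ finite_nbrs[of u]]) (auto simp: U_def nbrs_def)
  have "nbrs u \<subseteq> h ` H \<union> U"
  proof
    fix a assume a: "a \<in> nbrs u"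
    show "a \<in> h ` H \<union> U"
    proof (cases "\<exists>p\<in>P. hits u p a")
      case True
      then obtain p where "p \<in> P" "hits u p a" by blast
      then have "p \<in> H" "h p = a" using a h by (auto simp: nbrs_def H_def)
      then show ?thesis by blast
    qed (use a in \<open>auto simp: U_def nbrs_def\<close>)
  qed
  then have "k \<le> card (h ` H \<union> U)"
    using card_mono[of "h ` H \<union> U" "nbrs u"] card_nbrs_eq[OF u] fin \<open>finite U\<close> by auto
  also have "\<dots> \<le> card (h ` H) + card U" by (rule card_Un_le)
  finally have "k - 1 \<le> card (h ` H)" using U by linarith
  moreover have "card (h ` H) \<le> card H" using fin by (rule card_image_le)
  moreover have "card H \<le> card P" using P(3) by (intro card_mono) (auto simp: H_def)
  \<comment> \<open>The bounds form a chain from \<open>k - 1\<close> up to \<open>card P\<close>,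
    which is at most \<open>k - 1\<close>, so all are equalities.\<close>
  ultimately have eq: "card (h ` H) = card H" "card H = card P" and card_P: "card P = k - 1"
    using P(2) by linarith+
  have "H = P" using eq(2) P(3) by (intro card_subset_eq) (auto simp: H_def)
  have inj: "inj_on h P" using eq_card_imp_inj_on[OF fin eq(1)] \<open>H = P\<close> by simp
  show "card P = k - 1" by (fact card_P)
  show "\<exists>a. adj u a \<and> hits u p a" if "p \<in> P" for p
    using that \<open>H = P\<close> by (auto simp: H_def)
  show "p = p'" if "p \<in> P" "p' \<in> P" "adj u a" "hits u p a" "hits u p' a" for p p' a
    using inj_onD[OF inj _ that(1,2)] h that(3-5) by metis
qed

text \<open>If both pencils were separated, there would be at least two probes, so some
  \<open>p\<close> would miss the common neighbour \<open>m\<close>. It hits some \<open>a\<close>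
  next to \<open>u\<close> and some \<open>b\<close> next to \<open>w\<close>, both different from
  \<open>m\<close> and hence from each other, and no other probe tells \<open>a\<close> from
  \<open>b\<close>.\<close>

lemma indistinguishable_nbrs:
  assumes uw: "u \<in> pverts G" "w \<in> pverts G" "u \<noteq> w" "side u = side w"
    and P: "P \<subseteq> pverts G" "card P < k" "finite P"
  shows "\<exists>a b. a \<noteq> b \<and> a \<in> nbrs u \<union> nbrs w \<and> b \<in> nbrs u \<union> nbrs w \<and>
    (\<forall>p\<in>P. same_dist p a b)"
proof (rule ccontr)
  assume neg: "\<not> ?thesis"
  have sep: "a = b" if "a \<in> nbrs u \<union> nbrs w" "b \<in> nbrs u \<union> nbrs w"
    "\<forall>p\<in>P. same_dist p a b" for a b
    using neg that by blast
  have "\<forall>a b. adj u a \<longrightarrow> adj u b \<longrightarrow> (\<forall>p\<in>P. same_dist p a b) \<longrightarrow> a = b"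
    using sep by (simp add: nbrs_def)
  note U = separating_probes_hit[OF uw(1) P this]
  have "\<forall>a b. adj w a \<longrightarrow> adj w b \<longrightarrow> (\<forall>p\<in>P. same_dist p a b) \<longrightarrow> a = b"
    using sep by (simp add: nbrs_def)
  note W = separating_probes_hit[OF uw(2) P this]
  obtain m where m: "adj u m" "adj w m" using common_nbr_obtain[OF uw] by blast
  have "\<exists>p\<in>P. \<not> hits u p m"
  proof (rule ccontr)
    assume "\<not> ?thesis"
    then have "\<forall>p\<in>P. \<forall>p'\<in>P. p = p'" using U(3)[OF _ _ m(1)] by blast
    then have "card P \<le> 1" using card_le_Suc0_iff_eq[OF P(3)] by simp
    then show False using U(1) k_ge_3 by simp
  qed
  then obtain p where p: "p \<in> P" "\<not> hits u p m" by blast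
  obtain a where a: "adj u a" "hits u p a" using U(2)[OF p(1)] by blast
  obtain b where b: "adj w b" "hits w p b" using W(2)[OF p(1)] by blast
  have side: "side a = side b" using side_neq[OF a(1)] side_neq[OF b(1)] uw(4) by blast
  \<comment> \<open>Since every probe hits in both pencils, neither \<open>u\<close> nor
    \<open>w\<close> is probed.\<close>
  have pu: "\<not> hits u u c" "\<not> hits w w c" if "adj u c \<or> adj w c" for c
    using that not_adj_same_side uw(4) by (auto simp: hits_def)
  have "p \<noteq> u" "p \<noteq> w" using U(2)[OF p(1)] W(2)[OF p(1)] pu by blast+
  have "a \<noteq> m" using a p by blast
  have "b \<noteq> m"
    using b p \<open>p \<noteq> u\<close> by (auto simp: hits_def)
  have "a \<noteq> b"
    using common_nbr_unique[OF m a(1) _ uw(3)] b(1) \<open>a \<noteq> m\<close> by blast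
  have "same_dist p' a b" if p': "p' \<in> P" for p'
  proof (cases "p' = p")
    case True
    \<comment> \<open>Were \<open>p\<close> one of \<open>a\<close> and \<open>b\<close>, it would
      hit the other as a neighbour, although both lie on the same side.\<close>
    have "adj p a" "adj p b" "p \<noteq> a" "p \<noteq> b"
      using a(2) b(2) \<open>a \<noteq> b\<close> not_adj_same_side[of a b] not_adj_same_side[of b a]
        not_adj_same_side[of p p] side
      by (auto simp: hits_def)
    then show ?thesis
      using True p(1) P(1) a b side adj_verts by (subst same_dist_iff) auto
  next
    case False
    then have "\<not> hits u p' a" "\<not> hits w p' b"
      using U(3)[OF p' p(1) a(1) _ a(2)] W(3)[OF p' p(1) b(1) _ b(2)] by blast+
    moreover have "p' \<noteq> u" "p' \<noteq> w" using U(2)[OF p'] W(2)[OF p'] pu by blast+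
    ultimately show ?thesis
      using p' P(1) a b side adj_verts by (subst same_dist_iff) (auto simp: hits_def)
  qed
  then have "a = b" using sep a b by (simp add: nbrs_def)
  with \<open>a \<noteq> b\<close> show False by blast
qed

text \<open>The evasion relation is being distinct and on the same side; it persists because all
  neighbours of such a pair lie on one side.\<close>

lemma not_cops_win_less:
  assumes "j < k"
  shows "\<not> cops_win G j"
proof -
  define R where "R u w \<longleftrightarrow> u \<noteq> w \<and> side u = side w" for u w
  obtain v where v: "v \<in> pverts G" using verts_nonempty by blast
  obtain u0 where u0: "adj v u0" using nbr_obtain[OF v] by blast
  obtain w0 where w0: "adj v w0" "w0 \<noteq> u0" using nbr_obtain[OF v] by blast
  show ?thesis
  proof (rule not_cops_win_if_indistinguishable[of G R u0 w0])
    show "R u0 w0" using w0(2) side_nbrs[OF u0 w0(1)] by (simp add: R_def)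
    show "u0 \<in> pverts G" "w0 \<in> pverts G" using u0 w0 adj_verts by blast+
    fix u w ps
    assume uw: "R u w" "u \<in> pverts G" "w \<in> pverts G" and ps: "length ps = j" "set ps \<subseteq> pverts G"
    have "card (set ps) < k" using card_length[of ps] ps(1) assms by linarith
    then obtain a b where ab: "a \<noteq> b" "a \<in> nbrs u \<union> nbrs w" "b \<in> nbrs u \<union> nbrs w"
      "\<forall>p\<in>set ps. same_dist p a b"
      using indistinguishable_nbrs[of u w "set ps"] uw ps(2) unfolding R_def by auto
    then have "adj u a \<or> adj w a" "adj u b \<or> adj w b" by (auto simp: nbrs_def)
    then have "side a = side b" using uw(1) side_neq unfolding R_def by metis
    then have "R a b" using ab(1) by (simp add: R_def)
    with ab show "\<exists>a b. R a b \<and> a \<in> closed_nbhd G {u, w} \<and> b \<in> closed_nbhd G {u, w} \<and>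
        (\<forall>p\<in>set ps. graph_dist G p a = graph_dist G p b)"
      by (intro exI[of _ a] exI[of _ b]) (auto simp: closed_nbhd_def nbrs_def same_dist_def)
  qed (auto simp: R_def adj_verts)
qed

subsection \<open>Strategies for \<open>k\<close> cops\<close>

lemma cops_win_from_probe_set:
  assumes P: "card P = k" "P \<subseteq> pverts G"
    and step: "\<And>y. y \<in> C \<Longrightarrow>
      (\<forall>y'\<in>C. (\<forall>p\<in>P. same_dist p y y') \<longrightarrow> y' = y) \<or>
      (\<exists>S. cops_win_from G k (closed_nbhd G S) \<and>
        (\<forall>y'\<in>C. (\<forall>p\<in>P. same_dist p y y') \<longrightarrow> y' \<in> S))"
  shows "cops_win_from G k C"
proof -
  have "finite P" using finite_subset[OF P(2) pair_finite_verts] .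
  then obtain ps where ps: "set ps = P" "distinct ps"
    using finite_distinct_list by blast
  show ?thesis
  proof (rule cops_win_from_probe[of ps])
    show "length ps = k" using ps P(1) distinct_card by fastforce
  qed (use P(2) step in \<open>simp_all add: ps(1) same_dist_def\<close>)
qed

text \<open>Read \<open>x\<close> as a point and \<open>T\<close> as lines through it. The
  transversals are lines through a second point \<open>z\<close> of a line \<open>l0\<close> through
  \<open>x\<close> outside \<open>T\<close>, other than \<open>l0\<close>. They meet each other only
  in \<open>z\<close>, which is on no line of \<open>T\<close>, so they cut every such line in
  distinct points.\<close>

lemma transversal_probes:
  assumes x: "x \<in> pverts G" and T: "T \<subseteq> nbrs x" "T \<noteq> {}"
  shows "\<exists>M\<subseteq>pverts G. card M = k - card T \<and> (\<forall>m\<in>M. side m \<noteq> side x) \<and> (\<forall>m\<in>M. \<not> adj x m) \<and>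
    (\<forall>l\<in>T. \<forall>m\<in>M. \<forall>m'\<in>M. \<forall>s. adj l s \<longrightarrow> adj m s \<longrightarrow> adj m' s \<longrightarrow> m = m')"
proof (cases "T = nbrs x")
  case True
  then show ?thesis using card_nbrs_eq[OF x] by (intro exI[of _ "{}"]) simp
next
  case False
  then obtain l0 where l0: "adj x l0" "l0 \<notin> T" using T by (auto simp: nbrs_def)
  obtain z where z: "adj l0 z" "z \<noteq> x" using nbr_obtain adj_verts(2)[OF l0(1)] by blast
  have zV: "z \<in> pverts G" using z adj_verts by blast
  have "l0 \<in> nbrs z" using z(1) adj_sym by (simp add: nbrs_def)
  then have "card (nbrs z - {l0}) = k - 1" using card_nbrs_eq[OF zV] by simp
  moreover have "card T > 0" using T finite_subset[OF T(1)] by (simp add: card_gt_0_iff)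
  ultimately have "k - card T \<le> card (nbrs z - {l0})" by linarith
  then obtain M where M: "M \<subseteq> nbrs z - {l0}" "card M = k - card T"
    by (meson obtain_subset_with_card_n)
  have side: "side x = side z" using l0 z side_two_steps by blast
  have zM: "adj z m" "m \<noteq> l0" if "m \<in> M" for m using that M(1) by (auto simp: nbrs_def)
  show ?thesis
  proof (intro exI[of _ M] conjI M(2) ballI allI impI)
    show "M \<subseteq> pverts G" using zM adj_verts by blast
    show "side m \<noteq> side x" if "m \<in> M" for m using zM(1)[OF that] side side_neq by metis
    show "\<not> adj x m" if "m \<in> M" for m
    proof
      assume "adj x m"
      then have "m = l0"
        using common_nbr_unique[of x m z l0] zM(1)[OF that] z l0 adj_sym by metis
      then show False using zM(2)[OF that] by blast
    qed
    show "m = m'" if *: "l \<in> T" "m \<in> M" "m' \<in> M" "adj l s" "adj m s" "adj m' s" for l m m' s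
    proof (rule ccontr)
      assume "m \<noteq> m'"
      then have "s = z"
        using common_nbr_unique[of m s m' z] * zM adj_sym by metis
      moreover have "adj x l" using *(1) T(1) by (auto simp: nbrs_def)
      ultimately have "l = l0"
        using common_nbr_unique[of x l z l0] z l0 *(4) adj_sym by metis
      then show False using l0 *(1) by blast
    qed
  qed
qed

text \<open>
  The probes are \<open>T\<close> itself, which reveals the line carrying the robber's point, together with
  \<open>k - card T\<close> transversals, each of which excludes a further point of that line other than \<open>x\<close>.
\<close>

lemma cops_win_from_pencil:
  assumes "x \<in> pverts G" "T \<subseteq> nbrs x" "card T \<ge> 2"
  shows "cops_win_from G k (closed_nbhd G T)"
  using assms
proof (induction "card T" arbitrary: x T rule: less_induct)
  case less
  note x = less.prems(1) and T = less.prems(2,3)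
  have finT: "finite T" using T(1) finite_subset finite_nbrs by blast
  have "T \<noteq> {}" using T(2) by auto
  obtain M where "M \<subseteq> pverts G" "card M = k - card T"
    "\<forall>m\<in>M. side m \<noteq> side x" "\<forall>m\<in>M. \<not> adj x m"
    "\<forall>l\<in>T. \<forall>m\<in>M. \<forall>m'\<in>M. \<forall>s. adj l s \<longrightarrow> adj m s \<longrightarrow> adj m' s \<longrightarrow> m = m'"
    using transversal_probes[OF x T(1) \<open>T \<noteq> {}\<close>] by (elim exE conjE)
  note M = this(1,2) this(3-5)[rule_format]
  have finM: "finite M" using finite_subset[OF M(1) pair_finite_verts] .
  have xT: "adj x l" "adj l x" if "l \<in> T" for l using that T(1) adj_sym by (auto simp: nbrs_def)
  have TV: "T \<subseteq> pverts G" using xT adj_verts by blast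
  have CV: "closed_nbhd G T \<subseteq> pverts G" using TV adj_verts by (auto simp: closed_nbhd_def)
  have disj: "T \<inter> M = {}" using xT M(4) by blast
  have Tk: "card T \<le> k" using card_mono[OF finite_nbrs T(1)] card_nbrs_eq[OF x] by simp
  have "\<not> card T \<le> Suc 0" using T(2) by simp
  then obtain l1 l2 where l12: "l1 \<in> T" "l2 \<in> T" "l1 \<noteq> l2"
    unfolding card_le_Suc0_iff_eq[OF finT] by blast
  have adj_eq: "adj p y \<longleftrightarrow> adj p y'"
    if "p \<in> T \<union> M" "y \<in> closed_nbhd G T" "y' \<in> closed_nbhd G T" "\<forall>p\<in>T \<union> M. same_dist p y y'"
    for p y y'
  proof -
    have "p \<in> pverts G" using that(1) TV M(1) by blast
    then show ?thesis using that same_dist_iff[of p y y'] CV by blast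
  qed
  have xC: "x \<in> closed_nbhd G T" using l12 xT by (auto simp: closed_nbhd_def)
  \<comment> \<open>Two lines of \<open>T\<close> already determine \<open>x\<close>; this is where
    \<open>card T \<ge> 2\<close> enters.\<close>
  have x_unique: "y = x" if "\<forall>l\<in>T. adj l y" for y
    using common_nbr_unique[of l1 y l2 x] that l12 xT by blast
  show ?case
  proof (rule cops_win_from_probe_set[of "T \<union> M"])
    show "card (T \<union> M) = k"
      using card_Un_disjoint[OF finT finM disj] M(2) Tk by simp
    show "T \<union> M \<subseteq> pverts G" using TV M(1) by blast
    fix y assume y: "y \<in> closed_nbhd G T"
    let ?cls = "\<lambda>y'. y' \<in> closed_nbhd G T \<and> (\<forall>p\<in>T \<union> M. same_dist p y y')"
    have "(\<forall>y'. ?cls y' \<longrightarrow> y' = y) \<or>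
      (\<exists>S. cops_win_from G k (closed_nbhd G S) \<and> (\<forall>y'. ?cls y' \<longrightarrow> y' \<in> S))"
    proof (cases "y \<in> T")
      case True
      have "y' = y" if "?cls y'" for y'
        using that True same_dist_iff[of y y y'] TV CV by blast
      then show ?thesis by blast
    next
      case False
      then obtain l where l: "l \<in> T" "adj l y" using y by (auto simp: closed_nbhd_def)
      have lV: "l \<in> pverts G" using l(1) TV by blast
      have cls_l: "adj l y'" if "?cls y'" for y'
        using adj_eq[of l y y'] l y that by blast
      have cls_x: "y = x" if "?cls x"
        using adj_eq[of _ y x] y that xT(2) by (intro x_unique) blast
      show ?thesis
      \<comment> \<open>In the first case the robber is caught: \<open>x\<close> alone is on all
        lines of \<open>T\<close>, and any other such point is the intersection of \<open>l\<close>
        with a transversal.\<close>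
      proof (cases "y = x \<or> (\<exists>m\<in>M. adj m y)")
        case True
        have "y' = y" if y': "?cls y'" for y'
        proof (cases "y = x")
          case True
          then have "\<forall>l\<in>T. adj l y'" using adj_eq[of _ y y'] y y' xT(2) by blast
          then show ?thesis using x_unique True by blast
        next
          case False
          then obtain m where m: "m \<in> M" "adj m y" using \<open>y = x \<or> _\<close> by blast
          then have "adj m y'" using adj_eq[of m y y'] y y' by blast
          moreover have "l \<noteq> m" using l(1) m(1) disj by blast
          ultimately show ?thesis
            using common_nbr_unique[of l y' m y] l(2) m(2) cls_l[OF y'] by blast
        qed
        then show ?thesis by blast
      next
        case False
        define D where "D = {s. adj l s \<and> s \<noteq> x \<and> (\<forall>m\<in>M. \<not> adj m s)}"
        have "\<exists>s. adj l s \<and> adj m s" if "m \<in> M" for m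
        proof -
          have "side l = side m" using side_neq[OF xT(1)[OF l(1)]] M(3)[OF that] by blast
          moreover have "l \<noteq> m" "m \<in> pverts G" using l(1) that disj M(1) by blast+
          ultimately show ?thesis using common_nbr_obtain[OF lV] by metis
        qed
        then obtain g where g: "\<And>m. m \<in> M \<Longrightarrow> adj l (g m)" "\<And>m. m \<in> M \<Longrightarrow> adj m (g m)"
          by metis
        have "inj_on g M"
        proof (rule inj_onI)
          fix m m' assume *: "m \<in> M" "m' \<in> M" "g m = g m'"
          show "m = m'"
            using M(5)[OF l(1) *(1,2) g(1)[OF *(1)] g(2)[OF *(1)]] g(2)[OF *(2)] *(3) by simp
        qed
        \<comment> \<open>No transversal passes through \<open>x\<close>, so \<open>x\<close> is
          excluded in addition to the \<open>k - card T\<close> intersection points, leaving at most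
          \<open>card T - 1\<close> candidates on \<open>l\<close>.\<close>
        then have card_g: "card (insert x (g ` M)) = Suc (k - card T)"
          using M(2,4) g(2) finM adj_sym by (subst card_insert_disjoint) (auto simp: card_image)
        have sub: "insert x (g ` M) \<subseteq> nbrs l"
          using g(1) xT(2)[OF l(1)] by (auto simp: nbrs_def)
        have "D \<subseteq> nbrs l - insert x (g ` M)"
          using g(2) by (auto simp: D_def nbrs_def)
        then have "card D \<le> card (nbrs l - insert x (g ` M))"
          by (intro card_mono) auto
        also have "\<dots> = k - Suc (k - card T)"
          using card_Diff_subset[OF _ sub] finM card_g card_nbrs_eq[OF lV] by simp
        finally have card_D: "card D < card T" using T(2) Tk by linarith
        have Dl: "D \<subseteq> nbrs l" by (auto simp: D_def nbrs_def)
        have cls_D: "y' \<in> D" if y': "?cls y'" for y'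
        proof -
          have "\<not> adj m y'" if "m \<in> M" for m
            using adj_eq[of m y y'] y y' that False by blast
          moreover have "y' \<noteq> x" using cls_x y' False by blast
          ultimately show ?thesis using cls_l[OF y'] by (simp add: D_def)
        qed
        show ?thesis
        \<comment> \<open>The candidates are neighbours of \<open>l\<close>, so the induction
          continues with \<open>l\<close> as centre and the two sides exchanged.\<close>
        proof (cases "card D \<ge> 2")
          case True
          then show ?thesis using less.hyps[OF card_D lV Dl] cls_D by blast
        next
          case False
          have "finite D" using Dl finite_subset finite_nbrs by blast
          then have "\<forall>a\<in>D. \<forall>b\<in>D. a = b"
            using False card_le_Suc0_iff_eq[of D] by auto
          moreover have "?cls y" using y by (simp add: same_dist_def)
          ultimately show ?thesis using cls_D by blast
        qed
      qed
    qed
    then show "(\<forall>y'\<in>closed_nbhd G T. (\<forall>p\<in>T \<union> M. same_dist p y y') \<longrightarrow> y' = y) \<or>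
      (\<exists>S. cops_win_from G k (closed_nbhd G S) \<and>
        (\<forall>y'\<in>closed_nbhd G T. (\<forall>p\<in>T \<union> M. same_dist p y y') \<longrightarrow> y' \<in> S))"
      by blast
  qed
qed

lemma cops_win_from_nbrs: "x \<in> pverts G \<Longrightarrow> cops_win_from G k (closed_nbhd G (nbrs x))"
  using cops_win_from_pencil[of x "nbrs x"] card_nbrs_eq[of x] k_ge_3 by simp

text \<open>
  As long as the robber keeps to the side \<open>s\<close>, the candidates on that side shrink: the probe \<open>y\<close>
  excludes its neighbours. The other \<open>k - 1\<close> probes force any vertex on the opposite side
  into a single neighbourhood.
\<close>

lemma cops_win_from_side:
  assumes "\<And>v. v \<in> T \<Longrightarrow> v \<in> pverts G \<and> side v = s"
  shows "cops_win_from G k ({v \<in> pverts G. side v \<noteq> s} \<union> T)"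
  using assms
proof (induction "card T" arbitrary: T rule: less_induct)
  case less
  note T = less.prems
  have finT: "finite T" by (rule finite_subset[OF _ pair_finite_verts]) (use T in blast)
  let ?C = "{v \<in> pverts G. side v \<noteq> s} \<union> T"
  obtain v where v: "v \<in> pverts G" using verts_nonempty by blast
  obtain v' where v': "adj v v'" using nbr_obtain[OF v] by blast
  have "\<exists>z. z \<in> pverts G \<and> side z \<noteq> s"
    using side_neq[OF v'] v adj_verts[OF v'] by blast
  then obtain z where z: "z \<in> pverts G" "side z \<noteq> s" by blast
  have "\<exists>y. y \<in> pverts G \<and> side y \<noteq> s \<and> (T \<noteq> {} \<longrightarrow> (\<exists>l\<in>T. adj y l))"
  proof (cases "T = {}")
    case False
    then obtain l where l: "l \<in> T" by blast
    obtain y where y: "adj l y" using nbr_obtain T[OF l] by blast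
    then have "side y \<noteq> s" using side_neq T[OF l] by blast
    then show ?thesis using l y adj_verts adj_sym by blast
  qed (use z in blast)
  then obtain y where y: "y \<in> pverts G" "side y \<noteq> s" "T \<noteq> {} \<longrightarrow> (\<exists>l\<in>T. adj y l)" by blast
  obtain l0 where l0: "adj z l0" using nbr_obtain[OF z(1)] by blast
  \<comment> \<open>\<open>y\<close> is on the side of \<open>z\<close> and so not among its
    neighbours; this makes exactly \<open>k\<close> probes.\<close>
  define P where "P = insert y (nbrs z - {l0})"
  have zP: "l \<in> pverts G" "side l = s" if "adj z l" for l
    using adj_verts[OF that] side_neq[OF that] z(2) by blast+
  have "y \<notin> nbrs z" using y(2) zP(2) by (auto simp: nbrs_def)
  then have "card P = Suc (card (nbrs z - {l0}))" unfolding P_def by simp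
  also have "card (nbrs z - {l0}) = k - 1"
    using card_nbrs_eq[OF z(1)] l0 by (simp add: nbrs_def)
  finally have cardP: "card P = k" using k_ge_3 by simp
  have PV: "P \<subseteq> pverts G" using zP y(1) by (auto simp: P_def nbrs_def)
  have CV: "?C \<subseteq> pverts G" using T by blast
  have same: "side c = side c'" "adj p c \<longleftrightarrow> adj p c'"
    if "c \<in> ?C" "c' \<in> ?C" "\<forall>p\<in>P. same_dist p c c'" "p \<in> P" for c c' p
  proof -
    have "c \<in> pverts G" "c' \<in> pverts G" "p \<in> pverts G" using that CV PV by blast+
    then show "side c = side c'" "adj p c \<longleftrightarrow> adj p c'"
      using that(3,4) same_dist_iff[of p c c'] by blast+
  qed
  have yP: "y \<in> P" by (simp add: P_def)
  show ?case
  proof (rule cops_win_from_probe_set[OF cardP PV], rule disjI2)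
    fix c assume c: "c \<in> ?C"
    let ?cls = "\<lambda>c'. c' \<in> ?C \<and> (\<forall>p\<in>P. same_dist p c c')"
    have "\<exists>S. cops_win_from G k (closed_nbhd G S) \<and> (\<forall>c'. ?cls c' \<longrightarrow> c' \<in> S)"
    proof (cases "\<exists>p\<in>P. adj p c")
      case True
      then obtain p where p: "p \<in> P" "adj p c" by blast
      have "c' \<in> nbrs p" if "?cls c'" for c'
        using same(2)[OF c _ _ p(1)] that p(2) by (simp add: nbrs_def)
      moreover have "p \<in> pverts G" using p(1) PV by blast
      ultimately show ?thesis using cops_win_from_nbrs by blast
    next
      case False
      have cls_False: "\<not> adj p c'" if "?cls c'" "p \<in> P" for c' p
        using same(2)[OF c _ _ that(2)] that False by blast
      show ?thesis
      proof (cases "side c = s")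
        case False
        \<comment> \<open>On the side of \<open>z\<close> every vertex is \<open>z\<close> or shares
          a neighbour with it; all neighbours of \<open>z\<close> but \<open>l0\<close> are probed
          and found non-adjacent, so \<open>l0\<close> remains.\<close>
        have "c' \<in> nbrs l0" if c': "?cls c'" for c'
        proof -
          have c'V: "c' \<in> pverts G" using c' CV by blast
          have "side c' = side z" using same(1)[OF c _ _ yP] c' False z(2) by blast
          obtain l where l: "adj z l" "adj c' l"
          proof (cases "c' = z")
            case True
            then show ?thesis using that l0 by blast
          next
            case False
            then show ?thesis
              using common_nbr_obtain[OF c'V z(1) _ \<open>side c' = side z\<close>] that by blast
          qed
          have "l = l0"
            using cls_False[OF c', of l] l adj_sym by (auto simp: P_def nbrs_def)
          then show ?thesis using l(2) adj_sym by (simp add: nbrs_def)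
        qed
        moreover have "l0 \<in> pverts G" using zP l0 by blast
        ultimately show ?thesis using cops_win_from_nbrs by blast
      next
        case True
        \<comment> \<open>By the choice of \<open>y\<close> this removes at least one candidate, and
          a move from \<open>T'\<close> ends in \<open>T'\<close> or on the opposite side.\<close>
        define T' where "T' = T - nbrs y"
        have "c \<in> T" using c True by blast
        then have "\<exists>l\<in>T. adj y l" using y(3) by blast
        then have "T' \<subset> T" by (auto simp: T'_def nbrs_def)
        then have "cops_win_from G k ({v \<in> pverts G. side v \<noteq> s} \<union> T')"
          using T by (intro less.hyps psubset_card_mono[OF finT]) auto
        moreover have "closed_nbhd G T' \<subseteq> {v \<in> pverts G. side v \<noteq> s} \<union> T'"
        proof
          fix w assume "w \<in> closed_nbhd G T'"
          then consider "w \<in> T'" | l where "l \<in> T'" "adj l w"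
            unfolding closed_nbhd_def by blast
          then show "w \<in> {v \<in> pverts G. side v \<noteq> s} \<union> T'"
          proof cases
            case 2
            then have "side l = s" using T \<open>T' \<subset> T\<close> by blast
            then show ?thesis using 2 side_neq[of l w] adj_verts(2)[of l w] by blast
          qed blast
        qed
        moreover have "c' \<in> T'" if "?cls c'" for c'
        proof -
          have "side c' = s" using same(1)[OF c _ _ yP] that True by blast
          moreover have "\<not> adj y c'" using cls_False[OF that yP] .
          ultimately show ?thesis using that by (auto simp: T'_def nbrs_def)
        qed
        ultimately show ?thesis using cops_win_from_mono by blast
      qed
    qed
    then show "\<exists>S. cops_win_from G k (closed_nbhd G S) \<and>
        (\<forall>c'\<in>?C. (\<forall>p\<in>P. same_dist p c c') \<longrightarrow> c' \<in> S)"
      by blast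
  qed
qed

text \<open>Initially nothing is known, so the candidates on the chosen side are all its
  vertices.\<close>

lemma cops_win_k: "cops_win G k"
proof -
  have "{v \<in> pverts G. side v \<noteq> True} \<union> {v \<in> pverts G. side v = True} = pverts G" by blast
  then show ?thesis
    using cops_win_from_side[of "{v \<in> pverts G. side v = True}" True]
    by (intro cops_win_if_cops_win_from) simp
qed

theorem localization_number_eq: "localization_number G = k"
  unfolding localization_number_def
  by (rule Least_equality) (use cops_win_k not_cops_win_less not_le in blast)+

end

section \<open>Symmetric designs\<close>

text \<open>Incident pairs are counted by points and by blocks; the number \<open>v\<close> of both
  is nonzero and cancels.\<close>

lemma symmetric_bibd_r_eq_k:
  assumes "symmetric_bibd X \<B> v b r k l"
  shows "r = k"
proof -
  have D: "finite X" "X \<noteq> {}" "card X = v" "\<B> \<subseteq> Pow X" "card \<B> = v"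
    "\<And>B. B \<in> \<B> \<Longrightarrow> card B = k" "\<And>x. x \<in> X \<Longrightarrow> card {B \<in> \<B>. x \<in> B} = r"
    using assms by (auto simp: symmetric_bibd_def bibd_def)
  have fin: "finite \<B>" using D(1,4) finite_subset by blast
  have "v * r = (\<Sum>x\<in>X. card {B \<in> \<B>. x \<in> B})" using D(3,7) by simp
  also have "\<dots> = (\<Sum>B\<in>\<B>. card {x \<in> X. x \<in> B})"
    using sum_multicount_gen[OF D(1) fin, of "\<lambda>x B. x \<in> B" "\<lambda>B. card {x \<in> X. x \<in> B}"] by simp
  also have "\<dots> = (\<Sum>B\<in>\<B>. k)"
  proof (rule sum.cong)
    fix B assume B: "B \<in> \<B>"
    then have "{x \<in> X. x \<in> B} = B" using D(4) by blast
    then show "card {x \<in> X. x \<in> B} = k" using D(6)[OF B] by simp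
  qed simp
  also have "\<dots> = v * k" using D(5) by simp
  finally have "v * r = v * k" .
  moreover have "v \<noteq> 0" using D(1-3) by auto
  ultimately show ?thesis by simp
qed

lemma symmetric_bibdD:
  assumes D: "symmetric_bibd X \<B> v b r k 1"
  shows "finite X" "X \<noteq> {}" "\<And>B. B \<in> \<B> \<Longrightarrow> B \<subseteq> X" "\<And>B. B \<in> \<B> \<Longrightarrow> card B = k"
    "\<And>x. x \<in> X \<Longrightarrow> card {B \<in> \<B>. x \<in> B} = k"
    "\<And>x y. x \<in> X \<Longrightarrow> y \<in> X \<Longrightarrow> x \<noteq> y \<Longrightarrow> \<exists>!B. B \<in> \<B> \<and> x \<in> B \<and> y \<in> B"
proof -
  have bibd: "bibd X \<B> v b k k 1"
    using D symmetric_bibd_r_eq_k[OF D] unfolding symmetric_bibd_def by blast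
  then have "finite X" "X \<noteq> {}" "\<B> \<subseteq> Pow X" "\<forall>B\<in>\<B>. card B = k"
    "\<forall>x\<in>X. card {B \<in> \<B>. x \<in> B} = k"
    "\<forall>x\<in>X. \<forall>y\<in>X. x \<noteq> y \<longrightarrow> card {B \<in> \<B>. x \<in> B \<and> y \<in> B} = 1"
    unfolding bibd_def by simp_all
  note design = this
  show "finite X" "X \<noteq> {}" by (fact design)+
  show "B \<subseteq> X" "card B = k" if "B \<in> \<B>" for B using design(3,4) that by auto
  show "card {B \<in> \<B>. x \<in> B} = k" if "x \<in> X" for x using design(5) that by simp
  fix x y assume "x \<in> X" "y \<in> X" "x \<noteq> y"
  then have "card {B \<in> \<B>. x \<in> B \<and> y \<in> B} = 1" using design(6) by simp
  then obtain B0 where "{B \<in> \<B>. x \<in> B \<and> y \<in> B} = {B0}" by (rule card_1_singletonE)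
  then have "B \<in> \<B> \<and> x \<in> B \<and> y \<in> B \<longleftrightarrow> B = B0" for B by auto
  then show "\<exists>!B. B \<in> \<B> \<and> x \<in> B \<and> y \<in> B" by simp
qed

text \<open>
  Dual of the design axiom: for \<open>x \<notin> A\<close> the blocks joining \<open>x\<close> to the \<open>k\<close> points of \<open>A\<close> are
  distinct, so they are all the \<open>r = k\<close> blocks through \<open>x\<close>.
\<close>

lemma symmetric_bibd_blocks_meet:
  assumes D: "symmetric_bibd X \<B> v b r k 1" and AB: "A \<in> \<B>" "B \<in> \<B>" "A \<noteq> B"
  shows "\<exists>!x. x \<in> A \<and> x \<in> B"
proof -
  note finX = symmetric_bibdD(1)[OF D] and sub = symmetric_bibdD(3)[OF D]
    and card_block = symmetric_bibdD(4)[OF D] and deg = symmetric_bibdD(5)[OF D]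
    and pair = symmetric_bibdD(6)[OF D]
  have unique: "B = B'" if *: "B \<in> \<B>" "B' \<in> \<B>" "x \<in> B" "y \<in> B" "x \<in> B'" "y \<in> B'" "x \<noteq> y"
    for B B' x y
  proof -
    have "x \<in> X" "y \<in> X" using sub[OF *(1)] *(3,4) by auto
    from pair[OF this *(7)] obtain B0 where B0: "\<forall>C. C \<in> \<B> \<and> x \<in> C \<and> y \<in> C \<longrightarrow> C = B0"
      by (rule ex1E)
    show ?thesis using B0[THEN spec, of B] B0[THEN spec, of B'] *(1-6) by simp
  qed
  have finA: "finite A" using finite_subset[OF sub[OF AB(1)] finX] .
  \<comment> \<open>Distinct blocks have equal size, so neither contains the other.\<close>
  have "\<not> B \<subseteq> A"
    using card_subset_eq[OF finA, of B] card_block[OF AB(1)] card_block[OF AB(2)] AB(3) by auto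
  then obtain x where x: "x \<in> B" "x \<notin> A" by blast
  have xX: "x \<in> X" using sub[OF AB(2)] x(1) by auto
  have "\<forall>y\<in>A. \<exists>C. C \<in> \<B> \<and> x \<in> C \<and> y \<in> C"
  proof
    fix y assume "y \<in> A"
    then have "y \<in> X" "x \<noteq> y" using sub[OF AB(1)] x(2) by auto
    from ex1_implies_ex[OF pair[OF xX this]] show "\<exists>C. C \<in> \<B> \<and> x \<in> C \<and> y \<in> C" .
  qed
  from bchoice[OF this] obtain j where "\<forall>y\<in>A. j y \<in> \<B> \<and> x \<in> j y \<and> y \<in> j y" ..
  then have j: "j y \<in> \<B>" "x \<in> j y" "y \<in> j y" if "y \<in> A" for y using that by simp_all
  \<comment> \<open>A block joining \<open>x\<close> to two points of \<open>A\<close> would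
    coincide with \<open>A\<close>, which misses \<open>x\<close>.\<close>
  have "inj_on j A"
  proof (rule inj_onI, rule ccontr)
    fix y y' assume *: "y \<in> A" "y' \<in> A" "j y = j y'" "y \<noteq> y'"
    then have "j y = A" using unique[of "j y" A y y'] j[OF *(1)] j(3)[OF *(2)] AB(1) by simp
    then show False using j(2)[OF *(1)] x(2) by simp
  qed
  then have "card (j ` A) = card {B \<in> \<B>. x \<in> B}"
    using deg[OF xX] card_block[OF AB(1)] by (simp add: card_image)
  moreover have "finite {B \<in> \<B>. x \<in> B}"
    by (rule finite_subset[of _ "Pow X"]) (use finX sub in auto)
  moreover have "j ` A \<subseteq> {B \<in> \<B>. x \<in> B}" using j(1,2) by auto
  ultimately have "j ` A = {B \<in> \<B>. x \<in> B}" by (intro card_subset_eq)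
  then have "B \<in> j ` A" using x(1) AB(2) by simp
  then obtain y where y: "y \<in> A" "B = j y" by blast
  show ?thesis
  proof (rule ex1I[of _ y])
    show yAB: "y \<in> A \<and> y \<in> B" using y j(3) by simp
    show "y' = y" if "y' \<in> A \<and> y' \<in> B" for y'
      using unique[OF AB(1,2), of y' y] that yAB AB(3) by auto
  qed
qed

text \<open>Unique common neighbours come from the design axiom for points and from its dual for
  blocks; the graph is regular because \<open>r = k\<close>.\<close>

lemma plane_graph_incidence_graph:
  assumes D: "symmetric_bibd X \<B> v b r k 1" and k: "3 \<le> k"
  shows "plane_graph (incidence_graph X \<B>) isl k"
proof -
  have bibd: "bibd X \<B> v b r k 1" using D unfolding symmetric_bibd_def by blast
  note X = symmetric_bibdD(2)[OF D] and sub = symmetric_bibdD(3)[OF D]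
    and card_block = symmetric_bibdD(4)[OF D] and deg = symmetric_bibdD(5)[OF D]
    and pair = symmetric_bibdD(6)[OF D]
  let ?G = "incidence_graph X \<B>"
  have verts: "pverts ?G = Inl ` X \<union> Inr ` \<B>" by (simp add: incidence_graph_def)
  have Inl_arc: "(Inl x, w) \<in> parcs ?G \<longleftrightarrow> (\<exists>B\<in>\<B>. x \<in> B \<and> w = Inr B)" for x w
    by (auto simp: incidence_graph_def dest: sub)
  have Inr_arc: "(Inr B, w) \<in> parcs ?G \<longleftrightarrow> B \<in> \<B> \<and> (\<exists>x\<in>B. w = Inl x)" for B w
    by (auto simp: incidence_graph_def dest: sub)
  interpret pair_graph ?G using pair_graph_incidence_graph[OF bibd] .
  show ?thesis
  proof
    show "isl u \<noteq> isl w" if "(u, w) \<in> parcs ?G" for u w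
      using that by (cases u) (auto simp: Inl_arc Inr_arc)
    show "card {w. (u, w) \<in> parcs ?G} = k" if "u \<in> pverts ?G" for u
    proof (cases u)
      case (Inl x)
      then have "{w. (u, w) \<in> parcs ?G} = Inr ` {B \<in> \<B>. x \<in> B}" by (auto simp: Inl_arc)
      moreover have "x \<in> X" using that Inl by (auto simp: verts)
      ultimately show ?thesis using deg by (simp add: card_image)
    next
      case (Inr B)
      have B: "B \<in> \<B>" using that Inr by (auto simp: verts)
      then have "{w. (u, w) \<in> parcs ?G} = Inl ` B" using Inr by (auto simp: Inr_arc)
      then show ?thesis using card_block[OF B] by (simp add: card_image)
    qed
    show "\<exists>!c. (u, c) \<in> parcs ?G \<and> (w, c) \<in> parcs ?G"
      if uw: "u \<in> pverts ?G" "w \<in> pverts ?G" "u \<noteq> w" "isl u = isl w" for u w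
    proof (cases u)
      case (Inl x)
      then obtain y where y: "w = Inl y" using uw(4) by (cases w) auto
      have xy: "x \<in> X" "y \<in> X" "x \<noteq> y" using uw Inl y by (auto simp: verts)
      obtain B where B: "B \<in> \<B>" "x \<in> B" "y \<in> B"
        "\<forall>B'. B' \<in> \<B> \<and> x \<in> B' \<and> y \<in> B' \<longrightarrow> B' = B"
        using pair[OF xy] unfolding Ex1_def by (elim exE conjE)
      show ?thesis
        unfolding Inl y
      proof (rule ex1I[of _ "Inr B"])
        show "(Inl x, Inr B) \<in> parcs ?G \<and> (Inl y, Inr B) \<in> parcs ?G"
          using B(1-3) by (simp add: Inl_arc)
        fix c assume "(Inl x, c) \<in> parcs ?G \<and> (Inl y, c) \<in> parcs ?G"
        then obtain B' where "c = Inr B'" "B' \<in> \<B>" "x \<in> B'" "y \<in> B'" by (auto simp: Inl_arc)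
        then show "c = Inr B" using B(4)[THEN spec, of B'] by simp
      qed
    next
      case (Inr A)
      then obtain B where B: "w = Inr B" using uw(4) by (cases w) auto
      have AB: "A \<in> \<B>" "B \<in> \<B>" "A \<noteq> B" using uw Inr B by (auto simp: verts)
      obtain x where x: "x \<in> A" "x \<in> B" "\<forall>y. y \<in> A \<and> y \<in> B \<longrightarrow> y = x"
        using symmetric_bibd_blocks_meet[OF D AB] unfolding Ex1_def by (elim exE conjE)
      show ?thesis
        unfolding Inr B
      proof (rule ex1I[of _ "Inl x"])
        show "(Inr A, Inl x) \<in> parcs ?G \<and> (Inr B, Inl x) \<in> parcs ?G"
          using x(1,2) AB by (simp add: Inr_arc)
        fix c assume "(Inr A, c) \<in> parcs ?G \<and> (Inr B, c) \<in> parcs ?G"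
        then obtain y where "c = Inl y" "y \<in> A" "y \<in> B" by (auto simp: Inr_arc)
        then show "c = Inl x" using x(3) by simp
      qed
    qed
    show "3 \<le> k" by (fact k)
    show "pverts ?G \<noteq> {}" using X by (simp add: verts)
  qed
qed

theorem theorem3p2:
  shows "(\<forall>(X :: 'a set) \<B> v b r k.
            symmetric_bibd X \<B> v b r k 1 \<and> k \<ge> 3 \<longrightarrow>
            localization_number (incidence_graph X \<B>) = k) \<and>
         (\<forall>(X :: 'a set) \<B> q.
            projective_plane X \<B> q \<and> q \<ge> 2 \<longrightarrow>
            localization_number (incidence_graph X \<B>) = q + 1)"
proof -
  have main: "localization_number (incidence_graph X \<B>) = k"
    if "symmetric_bibd X \<B> v b r k 1" "k \<ge> 3" for X :: "'a set" and \<B> v b r k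
    using plane_graph.localization_number_eq[OF plane_graph_incidence_graph[OF that]] .
  then show ?thesis
    unfolding projective_plane_def by auto
qed

end
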